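(* For every integer $n\ge 0$ let $\overline{H_n}$ be the $n$-ringbolt hitching with generating polynomial $\overline{H_n}(x)$, and let $H_n(x)$ be the generating polynomial of the $n$-hitch knot $H_n$. Then $$\overline{H_n}(x)=(2x+3)\,\overline{H_{n-1}}(x)+(x+2)\,H_{n-1}(x)\qquad (n\ge 1),$$ and $\overline{H_n}(x)$ is given by the closed form $$\overline{H_n}(x)=\left(x^2+4x+3\right)^n+\left(x^2-1\right)(2x+3)^n\qquad (n\ge 0).$$
   Context: A knot (diagram) means a shadow on the sphere $S^2$: a finite collection of closed curves whose only singularities are finitely many transverse double points, called crossings, with no over/under information, considered up to planar isotopy (several components and crossingless circles are allowed). The unknot $U$ is a single simple closed curve. Each crossing can be split in two ways: remove the crossing and reconnect the four ends in one of the two planar non-crossing ways that join adjacent ends (type $0$ and type $1$ splits). A state of a knot $K$ with $m$ crossings is one of the $2^m$ diagrams obtained by choosing a split at each crossing; it is a disjoint union of simple closed curves (circles), and $|S|$ denotes the number of circles of the state $S$. The generating polynomial of $K$ is $K(x)=\sum_S x^{|S|}$, summed over all $2^m$ states. Consider diagrams in a disc with four boundary ends NW, SW (left) and NE, SE (right); two such diagrams are put side by side by joining the NE and SE ends of the first to the NW and SW ends of the second. The hitch block has three crossings: one crossing $c$ on top, whose two upper ends are NW and NE; below it a horizontal row of two crossings $a,b$, where the two right ends of $a$ are joined to the two left ends of $b$ (upper to upper, lower to lower), the upper left end of $a$ and the upper right end of $b$ are joined to the lower left and lower right ends of $c$ respectively, and the lower left end of $a$ is SW and the lower right end of $b$ is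 SE. Put $n$ hitch blocks side by side; for $n=0$ take two disjoint horizontal strands NW–NE and SW–SE. The $n$-hitch knot $H_n$ is obtained from this diagram by joining, outside the disc and without crossings, NW to SW and NE to SE (so $H_0=U$ and $H_1$ is the trefoil shadow). The $n$-ringbolt hitching $\overline{H_n}$, the closure of $H_n$, is obtained by instead joining, outside the disc by disjoint simple arcs, NW to NE and SW to SE ($\overline{H_0}$ is two disjoint circles). *)

theory Defs
  imports "HOL-Computational_Algebra.Polynomial" "HOL-Library.FuncSet"
begin

text \<open>
  A shadow is encoded by its combinatorial data (a planar diagram code without over/under
  information). A crossing has four ends, in cyclic order NW, NE, SE, SW; the two strands through
  it are NW--SE and NE--SW, so that this is the only place where curves meet. Away from the
  crossings a diagram consists of arcs between crossing ends and bivalent marked points.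
  Marked points carry no meaning of their own: they are points of the curves at which arcs
  are joined (the boundary points of a disc, for example), and they allow a circle without crossings
  to be represented by a cycle of arcs through at least three marked points. Arcs are sets of two
  points. Planarity is not imposed on this data: states and their circles depend only on the
  incidences and on which ends of a crossing are adjacent, and the diagrams below are transcribed
  from planar drawings.
\<close>

datatype corner = NW | NE | SW | SE

datatype ('c, 'm) point = End 'c corner | Mark 'm

record ('c, 'm) diagram =
  crossings :: "'c set"
  marks :: "'m set"
  arcs :: "('c, 'm) point set set"

definition points :: "('c, 'm) diagram \<Rightarrow> ('c, 'm) point set" where
  "points D = {End c k | c k. c \<in> crossings D} \<union> Mark ` marks D"

definition closed_diagram :: "('c, 'm) diagram \<Rightarrow> bool" where
  "closed_diagram D \<longleftrightarrow>
     finite (crossings D) \<and> finite (marks D) \<and>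
     (\<forall>e \<in> arcs D. e \<subseteq> points D \<and> card e = 2) \<and>
     (\<forall>c \<in> crossings D. \<forall>k. card {e \<in> arcs D. End c k \<in> e} = 1) \<and>
     (\<forall>m \<in> marks D. card {e \<in> arcs D. Mark m \<in> e} = 2)"


datatype split = Split0 | Split1

fun split_arcs :: "'c \<Rightarrow> split \<Rightarrow> ('c, 'm) point set set" where
  "split_arcs c Split0 = {{End c NW, End c NE}, {End c SW, End c SE}}"
| "split_arcs c Split1 = {{End c NW, End c SW}, {End c NE, End c SE}}"

definition states :: "('c, 'm) diagram \<Rightarrow> ('c \<Rightarrow> split) set" where
  "states D = crossings D \<rightarrow>\<^sub>E UNIV"

definition state_arcs :: "('c, 'm) diagram \<Rightarrow> ('c \<Rightarrow> split) \<Rightarrow> ('c, 'm) point set set" where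
  "state_arcs D S = arcs D \<union> (\<Union>c \<in> crossings D. split_arcs c (S c))"

definition same_circle :: "('c, 'm) diagram \<Rightarrow> ('c \<Rightarrow> split) \<Rightarrow> ('c, 'm) point rel" where
  "same_circle D S = {(p, q). p \<in> points D \<and> q \<in> points D \<and>
                              (p, q) \<in> {(u, v). {u, v} \<in> state_arcs D S}\<^sup>*}"

text \<open>
  In a state of a closed diagram every point lies on exactly two arcs, so the circles of the state
  are the connected components of the graph formed by its arcs.
\<close>

definition circles :: "('c, 'm) diagram \<Rightarrow> ('c \<Rightarrow> split) \<Rightarrow> ('c, 'm) point set set" where
  "circles D S = points D // same_circle D S"

definition gen_poly :: "('c, 'm) diagram \<Rightarrow> int poly" where
  "gen_poly D = (\<Sum>S \<in> states D. monom 1 (card (circles D S)))"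


text \<open>
  In a row of \<open>n\<close> hitch blocks, block \<open>i\<close> lies between the vertical seams \<open>i\<close> and \<open>Suc i\<close>, each of
  which is met by the diagram in an upper and a lower point: these are the left and right boundary
  ends of the block. The boundary ends of the whole disc are joined to the seams \<open>0\<close> and \<open>n\<close>, so
  that \<open>n = 0\<close> gives the two horizontal strands NW--NE and SW--SE.
\<close>

datatype block_crossing = Cross_a | Cross_b | Cross_c

datatype level = Upper | Lower

datatype hitch_mark = Seam nat level | Boundary corner

type_synonym hitch_crossing = "nat \<times> block_crossing"

type_synonym hitch_point = "(hitch_crossing, hitch_mark) point"

definition hitch_block :: "nat \<Rightarrow> hitch_point set set" where
  "hitch_block i =
     {{End (i, Cross_a) NE, End (i, Cross_b) NW},
      {End (i, Cross_a) SE, End (i, Cross_b) SW},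
      {End (i, Cross_a) NW, End (i, Cross_c) SW},
      {End (i, Cross_b) NE, End (i, Cross_c) SE},
      {Mark (Seam i Upper), End (i, Cross_c) NW},
      {Mark (Seam i Lower), End (i, Cross_a) SW},
      {End (i, Cross_c) NE, Mark (Seam (Suc i) Upper)},
      {End (i, Cross_b) SE, Mark (Seam (Suc i) Lower)}}"

definition hitch_row :: "nat \<Rightarrow> hitch_point set set" where
  "hitch_row n =
     (\<Union>i<n. hitch_block i) \<union>
     {{Mark (Boundary NW), Mark (Seam 0 Upper)},
      {Mark (Boundary SW), Mark (Seam 0 Lower)},
      {Mark (Seam n Upper), Mark (Boundary NE)},
      {Mark (Seam n Lower), Mark (Boundary SE)}}"

definition hitch_diagram :: "nat \<Rightarrow> hitch_point set set \<Rightarrow> (hitch_crossing, hitch_mark) diagram" where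
  "hitch_diagram n outer =
     \<lparr>crossings = {..<n} \<times> UNIV,
      marks = {Seam i l | i l. i \<le> n} \<union> range Boundary,
      arcs = hitch_row n \<union> outer\<rparr>"

definition hitch_knot :: "nat \<Rightarrow> (hitch_crossing, hitch_mark) diagram" where
  "hitch_knot n = hitch_diagram n
     {{Mark (Boundary NW), Mark (Boundary SW)}, {Mark (Boundary NE), Mark (Boundary SE)}}"

definition ringbolt_hitching :: "nat \<Rightarrow> (hitch_crossing, hitch_mark) diagram" where
  "ringbolt_hitching n = hitch_diagram n
     {{Mark (Boundary NW), Mark (Boundary NE)}, {Mark (Boundary SW), Mark (Boundary SE)}}"


text \<open>The diagrams considered are indeed closed: crossings are quadrivalent, marked points bivalent.\<close>

definition arcs_at :: "('c, 'm) point \<Rightarrow> ('c, 'm) point set set \<Rightarrow> ('c, 'm) point set set" where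
  "arcs_at p E = {e \<in> E. p \<in> e}"

lemma arcs_at_simps [simp]:
  "arcs_at p {} = {}"
  "arcs_at p (insert e E) = (if p \<in> e then insert e (arcs_at p E) else arcs_at p E)"
  "arcs_at p (E \<union> F) = arcs_at p E \<union> arcs_at p F"
  "arcs_at p (\<Union>i\<in>I. G i) = (\<Union>i\<in>I. arcs_at p (G i))"
  by (auto simp: arcs_at_def)

lemma finite_hitch_marks: "finite ({Seam i l | i l. i \<le> n} \<union> range Boundary)"
proof -
  have "{Seam i l | i l. i \<le> n} = (\<lambda>(i, l). Seam i l) ` ({..n} \<times> {Upper, Lower})"
    using level.exhaust by (auto simp: image_iff)
  moreover have "range Boundary = Boundary ` {NW, NE, SW, SE}"
    using corner.exhaust by (auto simp: image_iff)
  ultimately show ?thesis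
    by simp
qed

lemma finite_hitch_crossings: "finite ({..<n :: nat} \<times> (UNIV :: block_crossing set))"
proof -
  have eq: "(UNIV :: block_crossing set) = {Cross_a, Cross_b, Cross_c}"
    using block_crossing.exhaust by auto
  have "finite (UNIV :: block_crossing set)"
    unfolding eq by simp
  then show ?thesis
    by (intro finite_cartesian_product) simp_all
qed

lemma arcs_at_block_other:
  "j \<noteq> i \<Longrightarrow> arcs_at (End (i, b) k) (hitch_block j) = {}"
  by (simp add: hitch_block_def)

lemma UN_one_block:
  fixes X :: "nat \<Rightarrow> 'a set"
  assumes "\<And>j. j \<noteq> i \<Longrightarrow> X j = {}" "i < n"
  shows "(\<Union>j<n. X j) = X i"
proof (rule equalityI; rule subsetI)
  fix x assume "x \<in> (\<Union>j<n. X j)"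
  then obtain j where "x \<in> X j"
    by blast
  moreover from this have "j = i"
    using assms(1)[of j] by (cases "j = i") simp_all
  ultimately show "x \<in> X i"
    by simp
next
  fix x assume "x \<in> X i"
  then show "x \<in> (\<Union>j<n. X j)"
    using assms(2) by blast
qed

lemma arcs_at_row_end:
  assumes "i < n"
  shows "arcs_at (End (i, b) k) (hitch_row n) = arcs_at (End (i, b) k) (hitch_block i)"
proof -
  have UN: "(\<Union>j<n. arcs_at (End (i, b) k) (hitch_block j)) = arcs_at (End (i, b) k) (hitch_block i)"
    by (rule UN_one_block) (use assms in \<open>simp_all add: arcs_at_block_other\<close>)
  show ?thesis
    by (simp add: hitch_row_def UN)
qed

lemma card_arcs_at_block_end: "card (arcs_at (End (i, b) k) (hitch_block i)) = 1"
  by (cases b; cases k; simp add: hitch_block_def)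

lemma arcs_at_block_boundary [simp]: "arcs_at (Mark (Boundary k)) (hitch_block j) = {}"
  by (simp add: hitch_block_def)

lemma UN_two_blocks:
  fixes X :: "nat \<Rightarrow> 'a set"
  assumes "\<And>j. j \<noteq> i \<Longrightarrow> Suc j \<noteq> i \<Longrightarrow> X j = {}" "i \<le> n"
  shows "(\<Union>j<n. X j) = (if i < n then X i else {}) \<union> (if 0 < i then X (i - 1) else {})"
proof (rule equalityI; rule subsetI)
  fix x assume "x \<in> (\<Union>j<n. X j)"
  then obtain j where j: "j < n" "x \<in> X j"
    by blast
  then have "j = i \<or> Suc j = i"
    using assms(1)[of j] by (cases "j = i \<or> Suc j = i") simp_all
  then show "x \<in> (if i < n then X i else {}) \<union> (if 0 < i then X (i - 1) else {})"
    using j by (elim disjE) auto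
next
  fix x assume x: "x \<in> (if i < n then X i else {}) \<union> (if 0 < i then X (i - 1) else {})"
  show "x \<in> (\<Union>j<n. X j)"
  proof (cases "i < n \<and> x \<in> X i")
    case True
    then show ?thesis by blast
  next
    case False
    then have "0 < i" "x \<in> X (i - 1)"
      using x by (auto split: if_splits)
    moreover have "i - 1 < n"
      using \<open>0 < i\<close> assms(2) by simp
    ultimately show ?thesis by blast
  qed
qed

lemma card_arcs_at_row_seam:
  assumes "i \<le> n"
  shows "card (arcs_at (Mark (Seam i l)) (hitch_row n)) = 2"
proof -
  have empty: "arcs_at (Mark (Seam i l)) (hitch_block j) = {}" if "j \<noteq> i" "Suc j \<noteq> i" for j
    using that by (simp add: hitch_block_def)
  have UN: "(\<Union>j<n. arcs_at (Mark (Seam i l)) (hitch_block j)) =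
      (if i < n then arcs_at (Mark (Seam i l)) (hitch_block i) else {}) \<union>
      (if 0 < i then arcs_at (Mark (Seam i l)) (hitch_block (i - 1)) else {})"
    by (rule UN_two_blocks) (use empty assms in simp_all)
  have row: "arcs_at (Mark (Seam i l)) (hitch_row n) =
      {if i = 0 then {Mark (Boundary (if l = Upper then NW else SW)), Mark (Seam 0 l)}
         else {End (i - 1, if l = Upper then Cross_c else Cross_b)
                 (if l = Upper then NE else SE), Mark (Seam i l)},
       if i = n then {Mark (Seam n l), Mark (Boundary (if l = Upper then NE else SE))}
         else {Mark (Seam i l), End (i, if l = Upper then Cross_c else Cross_a)
                 (if l = Upper then NW else SW)}}"
    unfolding hitch_row_def arcs_at_simps(3) arcs_at_simps(4) UN
    using assms
    by (cases l; cases i; cases "i = n"; simp add: hitch_block_def; simp add: insert_commute)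
  show ?thesis
    unfolding row by (simp add: doubleton_eq_iff)
qed

lemma in_points_hitch_diagram [simp]:
  "End (i, b) k \<in> points (hitch_diagram n outer) \<longleftrightarrow> i < n"
  "Mark (Seam i l) \<in> points (hitch_diagram n outer) \<longleftrightarrow> i \<le> n"
  "Mark (Boundary k) \<in> points (hitch_diagram n outer)"
  by (auto simp: points_def hitch_diagram_def)

lemma hitch_block_points:
  "i < n \<Longrightarrow> \<forall>e \<in> hitch_block i. e \<subseteq> points (hitch_diagram n outer) \<and> card e = 2"
  by (simp add: hitch_block_def)

lemma hitch_row_points:
  "\<forall>e \<in> hitch_row n. e \<subseteq> points (hitch_diagram n outer) \<and> card e = 2"
  unfolding hitch_row_def ball_Un
proof
  show "\<forall>e \<in> (\<Union>i<n. hitch_block i). e \<subseteq> points (hitch_diagram n outer) \<and> card e = 2"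
    using hitch_block_points by blast
qed simp

lemma closed_hitch_diagram:
  assumes ends: "\<And>i b k. arcs_at (End (i, b) k) outer = {}"
    and seams: "\<And>i l. arcs_at (Mark (Seam i l)) outer = {}"
    and boundary: "\<And>k. card (arcs_at (Mark (Boundary k)) (hitch_row n \<union> outer)) = 2"
    and outer: "\<forall>e \<in> outer. e \<subseteq> points (hitch_diagram n outer) \<and> card e = 2"
  shows "closed_diagram (hitch_diagram n outer)"
proof -
  have crossings: "crossings (hitch_diagram n outer) = {..<n} \<times> UNIV"
    and marks: "marks (hitch_diagram n outer) = {Seam i l | i l. i \<le> n} \<union> range Boundary"
    and arcs: "arcs (hitch_diagram n outer) = hitch_row n \<union> outer"
    by (simp_all add: hitch_diagram_def)
  show ?thesis
    unfolding closed_diagram_def crossings marks arcs arcs_at_def[symmetric]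
  proof (intro conjI)
    show "\<forall>e \<in> hitch_row n \<union> outer. e \<subseteq> points (hitch_diagram n outer) \<and> card e = 2"
      using hitch_row_points outer by blast
    show "\<forall>c \<in> {..<n} \<times> UNIV. \<forall>k. card (arcs_at (End c k) (hitch_row n \<union> outer)) = 1"
    proof (intro ballI allI)
      fix c :: hitch_crossing and k
      assume "c \<in> {..<n} \<times> UNIV"
      then obtain i b where c: "c = (i, b)" and "i < n"
        by (cases c) simp
      show "card (arcs_at (End c k) (hitch_row n \<union> outer)) = 1"
        unfolding c arcs_at_simps(3) ends arcs_at_row_end[OF \<open>i < n\<close>] Un_empty_right
        by (rule card_arcs_at_block_end)
    qed
    show "\<forall>m \<in> {Seam i l | i l. i \<le> n} \<union> range Boundary.
            card (arcs_at (Mark m) (hitch_row n \<union> outer)) = 2"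
    proof
      fix m assume "m \<in> {Seam i l | i l. i \<le> n} \<union> range Boundary"
      then consider i l where "m = Seam i l" "i \<le> n" | k where "m = Boundary k"
        by blast
      then show "card (arcs_at (Mark m) (hitch_row n \<union> outer)) = 2"
      proof cases
        case 1
        then show ?thesis
          unfolding arcs_at_simps(3) by (simp only: seams Un_empty_right card_arcs_at_row_seam)
      next
        case 2
        then show ?thesis
          by (simp only: boundary)
      qed
    qed
  qed (rule finite_hitch_crossings finite_hitch_marks)+
qed

lemma arcs_at_row_boundary:
  "arcs_at (Mark (Boundary NW)) (hitch_row n) = {{Mark (Boundary NW), Mark (Seam 0 Upper)}}"
  "arcs_at (Mark (Boundary SW)) (hitch_row n) = {{Mark (Boundary SW), Mark (Seam 0 Lower)}}"
  "arcs_at (Mark (Boundary NE)) (hitch_row n) = {{Mark (Seam n Upper), Mark (Boundary NE)}}"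
  "arcs_at (Mark (Boundary SE)) (hitch_row n) = {{Mark (Seam n Lower), Mark (Boundary SE)}}"
  by (simp_all add: hitch_row_def)

lemma closed_hitch_knot: "closed_diagram (hitch_knot n)"
  unfolding hitch_knot_def
proof (rule closed_hitch_diagram)
  show "card (arcs_at (Mark (Boundary k)) (hitch_row n \<union> {{Mark (Boundary NW), Mark (Boundary SW)}, {Mark (Boundary NE), Mark (Boundary SE)}})) = 2" for k
    by (cases k) (simp_all add: arcs_at_row_boundary doubleton_eq_iff)
qed simp_all

lemma closed_ringbolt_hitching: "closed_diagram (ringbolt_hitching n)"
  unfolding ringbolt_hitching_def
proof (rule closed_hitch_diagram)
  show "card (arcs_at (Mark (Boundary k)) (hitch_row n \<union> {{Mark (Boundary NW), Mark (Boundary NE)}, {Mark (Boundary SW), Mark (Boundary SE)}})) = 2" for k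
    by (cases k) (simp_all add: arcs_at_row_boundary doubleton_eq_iff)
qed simp_all

end

theory Submission
  imports Defs
begin

text \<open>
  Splitting the three crossings of a hitch block turns it into a planar tangle with four ends, and
  there are only two of those up to closed circles: two horizontal strands, or two vertical strands.
  Of the eight choices of splits, five give the horizontal tangle, two of them with a circle left
  over inside the block, and three give the vertical tangle, one of them with such a circle.
  Counting a circle as a factor \<open>x\<close>, the horizontal tangle has total weight \<open>2x + 3\<close> and the
  vertical one \<open>x + 2\<close>.

  Now look at the last block of a row. A horizontal tangle there merely lengthens the two strands
  that run to the right boundary, so it may be dropped. A vertical tangle cuts the row: on its right
  side it joins the two right boundary ends to each other, and on its left side it closes the rest
  of the row. In the ringbolt closure this rest then becomes the hitch knot with one block less; in
  the knot closure it also becomes that hitch knot, but an additional circle appears on the right.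
  Hence \<open>Hbar(n + 1) = (2x + 3) Hbar(n) + (x + 2) H(n)\<close> and
  \<open>H(n + 1) = (2x + 3) H(n) + (x + 2) x H(n) = (x^2 + 4x + 3) H(n)\<close>. With \<open>H(0) = x\<close> and
  \<open>Hbar(0) = x^2\<close> the closed form follows by induction.

  The topological content is thus that replacing a part of a diagram by something equivalent
  preserves the number of circles. Circles are components of a graph, and two points lie in the
  same component iff every colouring of the points that is constant along arcs gives them the same
  colour. In these terms the equivalence of two graphs is a pair of maps between their points
  (\<open>num_components_equiv\<close>) whose required properties are implications between equations of
  colours. The block is treated in \<open>num_components_block\<close>, the two ways of closing a
  vertical tangle in \<open>tangle_circles_vertical_ringbolt\<close> and \<open>tangle_circles_vertical_knot\<close>.
\<close>

section \<open>Components of graphs and colourings\<close>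

definition constant_on_arcs :: "('p \<Rightarrow> 'c) \<Rightarrow> 'p set set \<Rightarrow> bool" where
  "constant_on_arcs \<phi> E \<longleftrightarrow> (\<forall>u v. {u, v} \<in> E \<longrightarrow> \<phi> u = \<phi> v)"

lemma constant_on_arcs_simps [simp]:
  "constant_on_arcs \<phi> {}"
  "constant_on_arcs \<phi> (insert {a, b} E) \<longleftrightarrow> \<phi> a = \<phi> b \<and> constant_on_arcs \<phi> E"
  "constant_on_arcs \<phi> (E \<union> F) \<longleftrightarrow> constant_on_arcs \<phi> E \<and> constant_on_arcs \<phi> F"
  by (auto simp: constant_on_arcs_def doubleton_eq_iff)

lemma constant_on_arcs_cong:
  assumes "\<And>x. x \<in> \<Union>E \<Longrightarrow> \<phi> x = \<psi> x"
  shows "constant_on_arcs \<phi> E \<longleftrightarrow> constant_on_arcs \<psi> E"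
proof -
  have "\<phi> u = \<psi> u \<and> \<phi> v = \<psi> v" if "{u, v} \<in> E" for u v
    using that by (intro conjI assms) auto
  then show ?thesis
    unfolding constant_on_arcs_def by metis
qed

definition linked :: "'p set set \<Rightarrow> 'p rel" where
  "linked E = {(u, v). {u, v} \<in> E}\<^sup>*"

lemma linked_imp_same_colour:
  assumes "(p, q) \<in> linked E" and "constant_on_arcs \<phi> E"
  shows "\<phi> p = \<phi> q"
  using assms(1) unfolding linked_def
  by (induction rule: rtrancl_induct)
    (use assms(2) in \<open>auto simp: constant_on_arcs_def\<close>)

lemma sym_linked: "sym (linked E)"
  unfolding linked_def by (rule sym_rtrancl) (auto simp: sym_def insert_commute)

lemma trans_linked: "trans (linked E)"
  unfolding linked_def by (rule trans_rtrancl)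

text \<open>
  The whole component is used, without intersecting it with a vertex set: then \<open>component E\<close> is
  itself a colouring that is constant on arcs, and it is the finest one.
\<close>

definition component :: "'p set set \<Rightarrow> 'p \<Rightarrow> 'p set" where
  "component E p = linked E `` {p}"

lemma component_eq_iff: "component E p = component E q \<longleftrightarrow> (p, q) \<in> linked E"
proof
  assume "component E p = component E q"
  moreover have "q \<in> component E q"
    by (simp add: component_def linked_def)
  ultimately show "(p, q) \<in> linked E"
    by (auto simp: component_def)
next
  assume "(p, q) \<in> linked E"
  then show "component E p = component E q"
    unfolding component_def using sym_linked[of E] trans_linked[of E]
    by (auto dest: symD transD)
qed

lemma constant_component: "constant_on_arcs (component E) E"
  unfolding constant_on_arcs_def component_eq_iff by (auto simp: linked_def)

definition num_components :: "'p set \<Rightarrow> 'p set set \<Rightarrow> nat" where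
  "num_components V E = card (component E ` V)"

lemma card_image_eq_if_same_kernel:
  assumes "\<And>x y. x \<in> A \<Longrightarrow> y \<in> A \<Longrightarrow> h x = h y \<longleftrightarrow> k x = k y"
  shows "card (h ` A) = card (k ` A)"
proof (rule bij_betw_same_card)
  have inv: "inv_into A h (h x) \<in> A" "h (inv_into A h (h x)) = h x" if "x \<in> A" for x
    using that by (auto intro: inv_into_into f_inv_into_f)
  have eq: "k (inv_into A h (h x)) = k x" if "x \<in> A" for x
    using assms[OF inv(1) that] inv(2) that by blast
  show "bij_betw (\<lambda>z. k (inv_into A h z)) (h ` A) (k ` A)"
    unfolding bij_betw_def
  proof
    show "inj_on (\<lambda>z. k (inv_into A h z)) (h ` A)"
      by (rule inj_onI) (auto simp: eq assms)
    show "(\<lambda>z. k (inv_into A h z)) ` h ` A = k ` A"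
      by (simp add: image_image eq cong: image_cong)
  qed
qed

text \<open>
  A circle is the part of a component that lies among the points of the diagram, so it determines
  the component.
\<close>

lemma card_circles: "card (circles D S) = num_components (points D) (state_arcs D S)"
proof -
  let ?E = "state_arcs D S"
  have circles: "circles D S = (\<lambda>p. points D \<inter> component ?E p) ` points D"
    by (auto simp: circles_def same_circle_def quotient_def component_def linked_def)
  have "points D \<inter> component ?E p = points D \<inter> component ?E q \<longleftrightarrow>
      component ?E p = component ?E q" if "p \<in> points D" "q \<in> points D" for p q
  proof
    assume "points D \<inter> component ?E p = points D \<inter> component ?E q"
    moreover have "q \<in> component ?E q"
      by (simp add: component_def linked_def)
    ultimately have "(p, q) \<in> linked ?E"
      using that by (auto simp: component_def)
    then show "component ?E p = component ?E q"
      by (simp add: component_eq_iff)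
  qed simp
  then have "card ((\<lambda>p. points D \<inter> component ?E p) ` points D) = card (component ?E ` points D)"
    by (rule card_image_eq_if_same_kernel)
  then show ?thesis
    by (simp add: num_components_def circles)
qed

text \<open>
  This is a combinatorial form of homotopy equivalence: \<open>f\<close> and \<open>g\<close> preserve connectivity and are
  mutually inverse up to connectivity, so they induce inverse bijections of components. Connectivity
  is expressed by colourings because the hypotheses can then be checked by equational reasoning
  where otherwise explicit paths would have to be given. Colours that are sets of points suffice,
  since components serve as colours.
\<close>

lemma num_components_equiv:
  fixes f :: "'p \<Rightarrow> 'q" and g :: "'q \<Rightarrow> 'p"
  assumes f: "\<And>x. x \<in> V \<Longrightarrow> f x \<in> W" and g: "\<And>y. y \<in> W \<Longrightarrow> g y \<in> V"
    and f_arcs: "\<And>\<psi> :: 'q \<Rightarrow> 'q set. constant_on_arcs \<psi> F \<Longrightarrow> constant_on_arcs (\<psi> \<circ> f) E"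
    and g_arcs: "\<And>\<phi> :: 'p \<Rightarrow> 'p set. constant_on_arcs \<phi> E \<Longrightarrow> constant_on_arcs (\<phi> \<circ> g) F"
    and gf: "\<And>\<phi> :: 'p \<Rightarrow> 'p set. \<And>x. constant_on_arcs \<phi> E \<Longrightarrow> x \<in> V \<Longrightarrow> \<phi> (g (f x)) = \<phi> x"
    and fg: "\<And>\<psi> :: 'q \<Rightarrow> 'q set. \<And>y. constant_on_arcs \<psi> F \<Longrightarrow> y \<in> W \<Longrightarrow> \<psi> (f (g y)) = \<psi> y"
  shows "num_components V E = num_components W F"
proof -
  let ?c = "component E" and ?d = "component F"
  have "?c x = ?c y \<longleftrightarrow> ?d (f x) = ?d (f y)" if "x \<in> V" "y \<in> V" for x y
  proof
    assume "?c x = ?c y"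
    then have "(x, y) \<in> linked E"
      by (simp add: component_eq_iff)
    from linked_imp_same_colour[OF this f_arcs[OF constant_component]]
    show "?d (f x) = ?d (f y)"
      by simp
  next
    assume "?d (f x) = ?d (f y)"
    then have "(f x, f y) \<in> linked F"
      by (simp add: component_eq_iff)
    from linked_imp_same_colour[OF this g_arcs[OF constant_component]]
    show "?c x = ?c y"
      using that by (simp add: gf constant_component)
  qed
  then have "card (?c ` V) = card ((\<lambda>x. ?d (f x)) ` V)"
    by (rule card_image_eq_if_same_kernel)
  also have "(\<lambda>x. ?d (f x)) ` V = ?d ` W"
  proof
    show "(\<lambda>x. ?d (f x)) ` V \<subseteq> ?d ` W"
      using f by blast
    show "?d ` W \<subseteq> (\<lambda>x. ?d (f x)) ` V"
    proof
      fix X assume "X \<in> ?d ` W"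
      then obtain y where "y \<in> W" "X = ?d y"
        by blast
      then show "X \<in> (\<lambda>x. ?d (f x)) ` V"
        using fg[OF constant_component, of y] g by (intro image_eqI[of _ _ "g y"]) auto
    qed
  qed
  finally show ?thesis
    by (simp add: num_components_def)
qed

text \<open>
  The case of \<open>num_components_equiv\<close> in which \<open>W\<close> is part of \<open>V\<close> and \<open>g\<close> is the inclusion.
\<close>

lemma num_components_retract:
  fixes r :: "'p \<Rightarrow> 'p"
  assumes "\<And>x. x \<in> V \<Longrightarrow> r x \<in> W" and "W \<subseteq> V"
    and "\<And>x. x \<in> W \<Longrightarrow> r x = x"
    and "\<And>\<psi> :: 'p \<Rightarrow> 'p set. constant_on_arcs \<psi> F \<Longrightarrow> constant_on_arcs (\<psi> \<circ> r) E"
    and "\<And>\<phi> :: 'p \<Rightarrow> 'p set. constant_on_arcs \<phi> E \<Longrightarrow> constant_on_arcs \<phi> F"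
    and "\<And>\<phi> :: 'p \<Rightarrow> 'p set. \<And>x. constant_on_arcs \<phi> E \<Longrightarrow> x \<in> V \<Longrightarrow> \<phi> (r x) = \<phi> x"
  shows "num_components V E = num_components W F"
  by (rule num_components_equiv[where f = r and g = id]) (use assms in auto)

lemma num_components_insert_isolated:
  assumes "finite V" "z \<notin> V" "z \<notin> \<Union>E"
  shows "num_components (insert z V) E = Suc (num_components V E)"
proof -
  have "component E z \<notin> component E ` V"
  proof
    assume "component E z \<in> component E ` V"
    then obtain x where "x \<in> V" "(z, x) \<in> linked E"
      by (auto simp: component_eq_iff)
    \<comment> \<open>Colouring \<open>z\<close> differently from all other points is allowed, as no arc meets \<open>z\<close>.\<close>
    have "constant_on_arcs (\<lambda>p. p = z) E"
      using assms(3) by (auto simp: constant_on_arcs_def)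
    from linked_imp_same_colour[OF \<open>(z, x) \<in> linked E\<close> this] show False
      using \<open>x \<in> V\<close> assms(2) by simp
  qed
  then show ?thesis
    using assms(1) by (simp add: num_components_def)
qed

section \<open>The states of a single hitch block\<close>

definition horizontal :: "nat \<Rightarrow> hitch_point set set" where
  "horizontal i = {{Mark (Seam i Upper), Mark (Seam (Suc i) Upper)},
                   {Mark (Seam i Lower), Mark (Seam (Suc i) Lower)}}"

definition vertical :: "nat \<Rightarrow> hitch_point set set" where
  "vertical i = {{Mark (Seam i Upper), Mark (Seam i Lower)},
                 {Mark (Seam (Suc i) Upper), Mark (Seam (Suc i) Lower)}}"

definition block_points :: "nat \<Rightarrow> hitch_point set" where
  "block_points i = {End (i, b) k | b k. True}"

definition block_state :: "nat \<Rightarrow> split \<Rightarrow> split \<Rightarrow> split \<Rightarrow> hitch_point set set" where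
  "block_state i a b c = hitch_block i \<union> split_arcs (i, Cross_a) a \<union>
     split_arcs (i, Cross_b) b \<union> split_arcs (i, Cross_c) c"

text \<open>
  The tangle formed by the three split crossings, with the splits in the order \<open>a\<close>, \<open>b\<close>, \<open>c\<close>. If
  \<open>c\<close> is split into an upper and a lower arc, the upper arc joins the two upper ends of the block
  and leaves only one way to join the lower ones; otherwise \<open>c\<close> continues the strands of the row
  formed by \<open>a\<close> and \<open>b\<close>, which is horizontal only if both \<open>a\<close> and \<open>b\<close> are.
\<close>

fun block_tangle :: "nat \<Rightarrow> split \<Rightarrow> split \<Rightarrow> split \<Rightarrow> hitch_point set set" where
  "block_tangle i a b Split0 = horizontal i"
| "block_tangle i Split0 Split0 Split1 = horizontal i"
| "block_tangle i Split1 b Split1 = vertical i"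
| "block_tangle i a Split1 Split1 = vertical i"

text \<open>
  A circle inside the block lies between \<open>a\<close> and \<open>b\<close> if both are split vertically; if all three
  crossings are split horizontally, one consists of the lower arc at \<open>c\<close> and the upper arcs at \<open>a\<close>
  and \<open>b\<close>.
\<close>

fun block_circles :: "split \<Rightarrow> split \<Rightarrow> split \<Rightarrow> nat" where
  "block_circles Split0 Split0 Split0 = 1"
| "block_circles Split1 Split1 c = 1"
| "block_circles a b c = 0"

text \<open>
  The arcs of \<open>hitch_block\<close> group the twelve crossing ends of the block into four that are joined to
  a boundary end of the block and four pairs. Only the pairs depend on the splits: the parameters
  are the images of the pair between \<open>c\<close> and \<open>a\<close>, the pair between \<open>c\<close> and \<open>b\<close>, and the upper and
  lower pairs between \<open>a\<close> and \<open>b\<close>.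
\<close>

fun block_retract ::
    "nat \<Rightarrow> hitch_point \<Rightarrow> hitch_point \<Rightarrow> hitch_point \<Rightarrow> hitch_point \<Rightarrow> hitch_point \<Rightarrow> hitch_point" where
  "block_retract n ca cb up lo (Mark m) = Mark m"
| "block_retract n ca cb up lo (End (i, b) k) =
    (if i \<noteq> n then End (i, b) k else
     (case (b, k) of
        (Cross_c, NW) \<Rightarrow> Mark (Seam n Upper)
      | (Cross_c, NE) \<Rightarrow> Mark (Seam (Suc n) Upper)
      | (Cross_c, SW) \<Rightarrow> ca
      | (Cross_c, SE) \<Rightarrow> cb
      | (Cross_a, SW) \<Rightarrow> Mark (Seam n Lower)
      | (Cross_a, NW) \<Rightarrow> ca
      | (Cross_a, NE) \<Rightarrow> up
      | (Cross_a, SE) \<Rightarrow> lo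
      | (Cross_b, SE) \<Rightarrow> Mark (Seam (Suc n) Lower)
      | (Cross_b, NE) \<Rightarrow> cb
      | (Cross_b, NW) \<Rightarrow> up
      | (Cross_b, SW) \<Rightarrow> lo))"

lemma block_retract_id: "x \<notin> block_points n \<Longrightarrow> block_retract n ca cb up lo x = x"
  by (cases "(n, ca, cb, up, lo, x)" rule: block_retract.cases) (auto simp: block_points_def)

lemma block_points_eq:
  "block_points n =
    {End (n, Cross_a) NW, End (n, Cross_a) NE, End (n, Cross_a) SW, End (n, Cross_a) SE,
     End (n, Cross_b) NW, End (n, Cross_b) NE, End (n, Cross_b) SW, End (n, Cross_b) SE,
     End (n, Cross_c) NW, End (n, Cross_c) NE, End (n, Cross_c) SW, End (n, Cross_c) SE}"
  (is "_ = ?X")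
proof
  show "block_points n \<subseteq> ?X"
  proof
    fix x assume "x \<in> block_points n"
    then obtain b k where "x = End (n, b) k"
      by (auto simp: block_points_def)
    then show "x \<in> ?X"
      by (cases b; cases k) simp_all
  qed
qed (auto simp: block_points_def)

lemma block_points_disjoint_block_tangle: "\<Union>(block_tangle n a b c) \<inter> block_points n = {}"
  by (cases a; cases b; cases c) (simp_all add: block_points_eq horizontal_def vertical_def)

abbreviation (input) "seam_ends n \<equiv> {Mark (Seam n Upper), Mark (Seam n Lower),
  Mark (Seam (Suc n) Upper), Mark (Seam (Suc n) Lower)} :: hitch_point set"

text \<open>
  Every crossing end is moved along its circle or strand to one of the four boundary ends of the
  block or, if it lies on a circle inside the block, to the north-east end of \<open>a\<close>. That point
  belongs to the inner circle in each of the three states that have one.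
\<close>

fun block_retraction :: "nat \<Rightarrow> split \<Rightarrow> split \<Rightarrow> split \<Rightarrow> hitch_point \<Rightarrow> hitch_point" where
  "block_retraction n Split0 Split0 Split0 =
    block_retract n (End (n, Cross_a) NE) (End (n, Cross_a) NE) (End (n, Cross_a) NE) (Mark (Seam n Lower))"
| "block_retraction n Split0 Split1 Split0 =
    block_retract n (Mark (Seam n Lower)) (Mark (Seam n Lower)) (Mark (Seam n Lower)) (Mark (Seam n Lower))"
| "block_retraction n Split1 Split0 Split0 =
    block_retract n (Mark (Seam n Lower)) (Mark (Seam n Lower)) (Mark (Seam n Lower)) (Mark (Seam n Lower))"
| "block_retraction n Split1 Split1 Split0 =
    block_retract n (Mark (Seam n Lower)) (Mark (Seam n Lower)) (End (n, Cross_a) NE) (End (n, Cross_a) NE)"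
| "block_retraction n Split0 Split0 Split1 =
    block_retract n (Mark (Seam n Upper)) (Mark (Seam (Suc n) Upper)) (Mark (Seam n Upper)) (Mark (Seam n Lower))"
| "block_retraction n Split0 Split1 Split1 =
    block_retract n (Mark (Seam n Upper)) (Mark (Seam (Suc n) Upper)) (Mark (Seam n Upper)) (Mark (Seam n Upper))"
| "block_retraction n Split1 Split0 Split1 =
    block_retract n (Mark (Seam n Upper)) (Mark (Seam (Suc n) Upper)) (Mark (Seam (Suc n) Upper)) (Mark (Seam (Suc n) Upper))"
| "block_retraction n Split1 Split1 Split1 =
    block_retract n (Mark (Seam n Upper)) (Mark (Seam (Suc n) Upper)) (End (n, Cross_a) NE) (End (n, Cross_a) NE)"

lemma block_retraction_id: "x \<notin> block_points n \<Longrightarrow> block_retraction n a b c x = x"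
  by (cases a; cases b; cases c) (simp_all add: block_retract_id)

lemma block_retraction_loop:
  "block_circles a b c \<noteq> 0 \<Longrightarrow> block_retraction n a b c (End (n, Cross_a) NE) = End (n, Cross_a) NE"
  by (cases a; cases b; cases c) simp_all

lemma block_retraction_image:
  "\<forall>x \<in> block_points n. block_retraction n a b c x \<in>
     seam_ends n \<union> (if block_circles a b c = 0 then {} else {End (n, Cross_a) NE})"
  by (cases a; cases b; cases c) (simp_all add: block_points_eq)

text \<open>
  With colourings as a language for connectivity, this says that the retraction does not leave the
  component of a point; it is a finite check in each of the eight states.
\<close>

lemma constant_on_block_state_imp_retraction:
  assumes "constant_on_arcs \<phi> (block_state n a b c)"
  shows "\<forall>x \<in> block_points n. \<phi> (block_retraction n a b c x) = \<phi> x"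
  using assms
  by (cases a; cases b; cases c;
      simp add: block_state_def hitch_block_def block_points_eq; (argo | simp)?)

lemma constant_on_block_state_imp_tangle:
  assumes "constant_on_arcs \<phi> (block_state n a b c)"
  shows "constant_on_arcs \<phi> (block_tangle n a b c)"
  using assms
  by (cases a; cases b; cases c;
      simp add: block_state_def hitch_block_def horizontal_def vertical_def; (argo | simp)?)

lemma constant_on_block_tangle_imp_state:
  assumes "constant_on_arcs \<psi> (block_tangle n a b c)"
  shows "constant_on_arcs (\<psi> \<circ> block_retraction n a b c) (block_state n a b c)"
  using assms
  by (cases a; cases b; cases c)
    (simp_all add: block_state_def hitch_block_def horizontal_def vertical_def)

text \<open>
  A block can be exchanged for its tangle in any surroundings \<open>V\<close>, \<open>E\<close> that meet it only in its
  boundary ends. The retraction maps onto \<open>V\<close>, together with one representative of the inner circle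
  if there is one; this representative is an isolated vertex of the smaller graph and accounts for
  the additional circle.
\<close>

lemma num_components_block:
  fixes V :: "hitch_point set"
  assumes "finite V" and seams: "seam_ends n \<subseteq> V"
    and V: "V \<inter> block_points n = {}" and E: "\<Union>E \<inter> block_points n = {}"
  shows "num_components (V \<union> block_points n) (E \<union> block_state n a b c) =
    num_components V (E \<union> block_tangle n a b c) + block_circles a b c"
proof -
  let ?z = "End (n, Cross_a) NE :: hitch_point" and ?r = "block_retraction n a b c"
  define W where "W = V \<union> (if block_circles a b c = 0 then {} else {?z})"
  have z: "?z \<in> block_points n" "?z \<notin> V" "?z \<notin> \<Union>(E \<union> block_tangle n a b c)"
    using V E block_points_disjoint_block_tangle[of n a b c] by (auto simp: block_points_def)
  have "num_components (V \<union> block_points n) (E \<union> block_state n a b c) =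
      num_components W (E \<union> block_tangle n a b c)"
  proof (rule num_components_retract[where r = ?r])
    show "W \<subseteq> V \<union> block_points n"
      using z by (auto simp: W_def)
    show "?r x = x" if "x \<in> W" for x
    proof (cases "x \<in> V")
      case True
      then show ?thesis
        using V by (intro block_retraction_id) blast
    next
      case False
      then show ?thesis
        using that by (auto simp: W_def block_retraction_loop split: if_splits)
    qed
    show "?r x \<in> W" if "x \<in> V \<union> block_points n" for x
    proof (cases "x \<in> block_points n")
      case True
      then show ?thesis
        using block_retraction_image[of n a b c] seams unfolding W_def by blast
    next
      case False
      then show ?thesis
        using that by (simp add: block_retraction_id W_def)
    qed
    show "constant_on_arcs (\<psi> \<circ> ?r) (E \<union> block_state n a b c)"
      if "constant_on_arcs \<psi> (E \<union> block_tangle n a b c)" for \<psi> :: "hitch_point \<Rightarrow> hitch_point set"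
    proof -
      have "constant_on_arcs (\<psi> \<circ> ?r) E \<longleftrightarrow> constant_on_arcs \<psi> E"
      proof (rule constant_on_arcs_cong)
        fix x assume "x \<in> \<Union>E"
        then have "x \<notin> block_points n"
          using E by blast
        then show "(\<psi> \<circ> ?r) x = \<psi> x"
          by (simp add: block_retraction_id)
      qed
      then show ?thesis
        using that by (simp add: constant_on_block_tangle_imp_state)
    qed
    show "constant_on_arcs \<phi> (E \<union> block_tangle n a b c)"
      if "constant_on_arcs \<phi> (E \<union> block_state n a b c)" for \<phi> :: "hitch_point \<Rightarrow> hitch_point set"
      using that by (simp add: constant_on_block_state_imp_tangle)
    show "\<phi> (?r x) = \<phi> x"
      if "constant_on_arcs \<phi> (E \<union> block_state n a b c)" for \<phi> :: "hitch_point \<Rightarrow> hitch_point set" and x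
      using that constant_on_block_state_imp_retraction[of \<phi> n a b c]
      by (cases "x \<in> block_points n") (simp_all add: block_retraction_id)
  qed
  also have "num_components W (E \<union> block_tangle n a b c) =
      num_components V (E \<union> block_tangle n a b c) + block_circles a b c"
    using num_components_insert_isolated[OF assms(1) z(2,3)]
    by (cases a; cases b; cases c) (simp_all add: W_def)
  finally show ?thesis .
qed

section \<open>Splitting off the last block of a row\<close>

definition row_points :: "nat \<Rightarrow> hitch_point set" where
  "row_points n = {End (i, b) k | i b k. i < n} \<union> {Mark (Seam i l) | i l. i \<le> n} \<union>
     {Mark (Boundary NW), Mark (Boundary NE), Mark (Boundary SW), Mark (Boundary SE)}"

lemma points_hitch_diagram: "points (hitch_diagram n outer) = row_points n"
proof -
  have "range Boundary = Boundary ` {NW, NE, SW, SE}"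
    using corner.exhaust by (auto simp: image_iff)
  then show ?thesis
    by (auto simp: points_def hitch_diagram_def row_points_def)
qed

lemma level_Upper_or_Lower: "l \<in> {Upper, Lower}"
  by (cases l) simp_all

lemma finite_row_points: "finite (row_points n)"
proof -
  have "row_points n \<subseteq> (\<Union>i<n. block_points i) \<union>
      (\<lambda>(i, l). Mark (Seam i l)) ` ({..n} \<times> {Upper, Lower}) \<union>
      {Mark (Boundary NW), Mark (Boundary NE), Mark (Boundary SW), Mark (Boundary SE)}"
    using level_Upper_or_Lower by (force simp: row_points_def block_points_def image_iff)
  moreover have "finite \<dots>"
    by (simp add: block_points_eq)
  ultimately show ?thesis
    by (rule finite_subset)
qed

lemma row_points_Suc:
  "row_points (Suc n) =
     (row_points n \<union> {Mark (Seam (Suc n) Upper), Mark (Seam (Suc n) Lower)}) \<union> block_points n"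
proof -
  have "l = Upper \<or> l = Lower" for l
    by (cases l) auto
  then show ?thesis
    by (auto simp: row_points_def block_points_def less_Suc_eq le_Suc_eq)
qed

text \<open>
  The split row up to its last seam. The two arcs from that seam to the right boundary are kept
  apart in \<open>right_ends\<close>, as they are what changes when a block is appended.
\<close>

definition row_state :: "nat \<Rightarrow> (hitch_crossing \<Rightarrow> split) \<Rightarrow> hitch_point set set" where
  "row_state n S =
     (\<Union>i<n. block_state i (S (i, Cross_a)) (S (i, Cross_b)) (S (i, Cross_c))) \<union>
     {{Mark (Boundary NW), Mark (Seam 0 Upper)}, {Mark (Boundary SW), Mark (Seam 0 Lower)}}"

definition right_ends :: "nat \<Rightarrow> hitch_point set set" where
  "right_ends n = {{Mark (Seam n Upper), Mark (Boundary NE)}, {Mark (Seam n Lower), Mark (Boundary SE)}}"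

lemma state_arcs_hitch_diagram:
  "state_arcs (hitch_diagram n outer) S = row_state n S \<union> right_ends n \<union> outer"
proof -
  have UNIV: "(UNIV :: block_crossing set) = {Cross_a, Cross_b, Cross_c}"
    using block_crossing.exhaust by auto
  have "(\<Union>c \<in> {..<n} \<times> UNIV. split_arcs c (S c)) =
      (\<Union>i<n. split_arcs (i, Cross_a) (S (i, Cross_a)) \<union> split_arcs (i, Cross_b) (S (i, Cross_b)) \<union>
        split_arcs (i, Cross_c) (S (i, Cross_c)) :: hitch_point set set)"
    unfolding UNIV by auto
  then have "row_state n S = (\<Union>i<n. hitch_block i) \<union> (\<Union>c \<in> {..<n} \<times> UNIV. split_arcs c (S c)) \<union>
      {{Mark (Boundary NW), Mark (Seam 0 Upper)}, {Mark (Boundary SW), Mark (Seam 0 Lower)}}"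
    by (simp only: row_state_def block_state_def UN_Un_distrib Un_assoc)
  then show ?thesis
    unfolding state_arcs_def hitch_diagram_def hitch_row_def right_ends_def by simp blast
qed

lemma row_state_points:
  "\<Union>(row_state n S) \<subseteq> {End (i, b) k | i b k. i < n} \<union> {Mark (Seam i l) | i l. i \<le> n} \<union>
     {Mark (Boundary NW), Mark (Boundary SW)}"
proof -
  have "\<Union>(block_state i a b c) \<subseteq> {End (i, b) k | i b k. i < n} \<union> {Mark (Seam i l) | i l. i \<le> n}"
    if "i < n" for i a b c
    using that by (cases a; cases b; cases c) (simp_all add: block_state_def hitch_block_def)
  then have blocks: "\<Union>(\<Union>i<n. block_state i (S (i, Cross_a)) (S (i, Cross_b)) (S (i, Cross_c))) \<subseteq>
      {End (i, b) k | i b k. i < n} \<union> {Mark (Seam i l) | i l. i \<le> n}"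
    by blast
  show ?thesis
    unfolding row_state_def Union_Un_distrib
    by (intro Un_least subset_trans[OF blocks]) auto
qed

lemma row_state_avoids:
  assumes "x \<in> \<Union>(row_state n S)"
  shows "x \<noteq> Mark (Seam (Suc n) l)" "x \<noteq> Mark (Boundary NE)" "x \<noteq> Mark (Boundary SE)"
    "x \<notin> block_points n"
  using subsetD[OF row_state_points assms] by (auto simp: block_points_def)

text \<open>
  The tangle \<open>T\<close> stands in for block \<open>n\<close> of a row of \<open>Suc n\<close> blocks. Both seams of the block are
  kept, although a row of \<open>n\<close> blocks ends at seam \<open>n\<close>: this separates the exchange of the block
  for a tangle from the removal of the tangle, which depends on the closure.
\<close>

definition tangle_circles ::
    "nat \<Rightarrow> hitch_point set set \<Rightarrow> (hitch_crossing \<Rightarrow> split) \<Rightarrow> hitch_point set set \<Rightarrow> nat" where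
  "tangle_circles n outer S T =
     num_components (row_points n \<union> {Mark (Seam (Suc n) Upper), Mark (Seam (Suc n) Lower)})
       (row_state n S \<union> right_ends (Suc n) \<union> outer \<union> T)"

definition extend_state ::
    "nat \<Rightarrow> (hitch_crossing \<Rightarrow> split) \<Rightarrow> split \<Rightarrow> split \<Rightarrow> split \<Rightarrow> hitch_crossing \<Rightarrow> split" where
  "extend_state n S a b c = (\<lambda>(i, x). if i = n then case_block_crossing a b c x else S (i, x))"

lemma row_state_extend: "row_state n (extend_state n S a b c) = row_state n S"
  by (simp add: row_state_def extend_state_def)

lemma row_state_Suc:
  "row_state (Suc n) S =
     row_state n S \<union> block_state n (S (n, Cross_a)) (S (n, Cross_b)) (S (n, Cross_c))"
  by (auto simp: row_state_def lessThan_Suc)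

lemma card_circles_extend_state:
  assumes outer: "\<Union>outer \<subseteq> range (Mark \<circ> Boundary)"
  shows "card (circles (hitch_diagram (Suc n) outer) (extend_state n S a b c)) =
    tangle_circles n outer S (block_tangle n a b c) + block_circles a b c"
proof -
  let ?V = "row_points n \<union> {Mark (Seam (Suc n) Upper), Mark (Seam (Suc n) Lower)}"
  let ?E = "row_state n S \<union> right_ends (Suc n) \<union> outer"
  have "state_arcs (hitch_diagram (Suc n) outer) (extend_state n S a b c) = ?E \<union> block_state n a b c"
    by (auto simp: state_arcs_hitch_diagram row_state_Suc row_state_extend)
      (auto simp: extend_state_def)
  moreover have "num_components (?V \<union> block_points n) (?E \<union> block_state n a b c) =
      num_components ?V (?E \<union> block_tangle n a b c) + block_circles a b c"
  proof (rule num_components_block)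
    have "\<Union>(row_state n S) \<inter> block_points n = {}"
      using row_state_avoids(4) by blast
    moreover have "\<Union>(right_ends (Suc n) \<union> outer) \<inter> block_points n = {}"
      using outer by (auto simp: right_ends_def block_points_def)
    ultimately show "\<Union>?E \<inter> block_points n = {}"
      by blast
    show "finite ?V"
      by (simp add: finite_row_points)
  qed (auto simp: row_points_def block_points_def)
  ultimately show ?thesis
    by (simp add: card_circles points_hitch_diagram row_points_Suc tangle_circles_def)
qed

text \<open>
  Contracting the two strands of the tangle identifies seam \<open>Suc n\<close> with seam \<open>n\<close>. The closing arcs
  have their ends on the boundary and are not affected.
\<close>

lemma tangle_circles_horizontal:
  assumes outer: "\<Union>outer \<subseteq> range (Mark \<circ> Boundary)"
  shows "tangle_circles n outer S (horizontal n) = card (circles (hitch_diagram n outer) S)"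
proof -
  let ?r = "\<lambda>x :: hitch_point. case x of Mark (Seam i l) \<Rightarrow> Mark (Seam (min i n) l) | _ \<Rightarrow> x"
  have fixed: "?r x = x" if "x \<in> \<Union>(row_state n S \<union> outer)" for x
  proof (cases "x \<in> \<Union>(row_state n S)")
    case True
    from subsetD[OF row_state_points this] show ?thesis
      by (auto simp: min_def)
  next
    case False
    then have "x \<in> range (Mark \<circ> Boundary)"
      using that outer by blast
    then show ?thesis
      by auto
  qed
  show ?thesis
    unfolding tangle_circles_def card_circles points_hitch_diagram state_arcs_hitch_diagram
  proof (rule num_components_retract[where r = ?r])
    fix \<psi> :: "hitch_point \<Rightarrow> hitch_point set"
    have "constant_on_arcs (\<psi> \<circ> ?r) (row_state n S \<union> outer) \<longleftrightarrow>
        constant_on_arcs \<psi> (row_state n S \<union> outer)"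
      by (rule constant_on_arcs_cong) (simp only: o_apply fixed)
    then show "constant_on_arcs (\<psi> \<circ> ?r) (row_state n S \<union> right_ends (Suc n) \<union> outer \<union> horizontal n)"
      if "constant_on_arcs \<psi> (row_state n S \<union> right_ends n \<union> outer)"
      using that by (simp add: right_ends_def horizontal_def)
  qed (auto simp: row_points_def right_ends_def horizontal_def)
qed

section \<open>Closing a row that ends in a vertical tangle\<close>

definition knot_arcs :: "hitch_point set set" where
  "knot_arcs = {{Mark (Boundary NW), Mark (Boundary SW)}, {Mark (Boundary NE), Mark (Boundary SE)}}"

definition ringbolt_arcs :: "hitch_point set set" where
  "ringbolt_arcs = {{Mark (Boundary NW), Mark (Boundary NE)}, {Mark (Boundary SW), Mark (Boundary SE)}}"

lemma constant_on_row_state_cong: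
  fixes \<psi> :: "hitch_point \<Rightarrow> 'c"
  assumes "\<And>x. (\<And>l. x \<noteq> Mark (Seam (Suc n) l)) \<Longrightarrow> x \<noteq> Mark (Boundary NE) \<Longrightarrow>
    x \<noteq> Mark (Boundary SE) \<Longrightarrow> f x = x"
  shows "constant_on_arcs (\<psi> \<circ> f) (row_state n S) \<longleftrightarrow> constant_on_arcs \<psi> (row_state n S)"
proof (rule constant_on_arcs_cong)
  fix x assume "x \<in> \<Union>(row_state n S)"
  from assms[OF row_state_avoids(1-3)[OF this]] show "(\<psi> \<circ> f) x = \<psi> x"
    by simp
qed

text \<open>
  The right part of the vertical tangle, together with the ringbolt arcs, forms a path from the
  north-west to the south-west boundary point. It plays the role of the left arc of the knot
  closure, and \<open>f\<close> contracts its upper and lower halves to the two ends. Conversely, the left part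
  of the vertical tangle plays the role of the right arc of the knot closure, so \<open>g\<close> has to move
  the right boundary points to seam \<open>n\<close>.
\<close>

lemma tangle_circles_vertical_ringbolt:
  "tangle_circles n ringbolt_arcs S (vertical n) = card (circles (hitch_knot n) S)"
proof -
  let ?E = "row_state n S \<union> right_ends (Suc n) \<union> ringbolt_arcs \<union> vertical n"
    and ?F = "row_state n S \<union> right_ends n \<union> knot_arcs"
  define f where "f = (\<lambda>x :: hitch_point.
    if x \<in> {Mark (Seam (Suc n) Upper), Mark (Boundary NE)} then Mark (Boundary NW)
    else if x \<in> {Mark (Seam (Suc n) Lower), Mark (Boundary SE)} then Mark (Boundary SW) else x)"
  define g where "g = (\<lambda>x :: hitch_point. if x = Mark (Boundary NE) then Mark (Seam n Upper)
    else if x = Mark (Boundary SE) then Mark (Seam n Lower) else x)"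
  have f_row: "constant_on_arcs (\<psi> \<circ> f) (row_state n S) \<longleftrightarrow> constant_on_arcs \<psi> (row_state n S)"
    for \<psi> :: "hitch_point \<Rightarrow> hitch_point set"
    by (rule constant_on_row_state_cong) (simp add: f_def)
  have g_row: "constant_on_arcs (\<psi> \<circ> g) (row_state n S) \<longleftrightarrow> constant_on_arcs \<psi> (row_state n S)"
    for \<psi> :: "hitch_point \<Rightarrow> hitch_point set"
    by (rule constant_on_row_state_cong) (simp add: g_def)
  show ?thesis
    unfolding tangle_circles_def card_circles hitch_knot_def knot_arcs_def[symmetric]
      points_hitch_diagram state_arcs_hitch_diagram
  proof (rule num_components_equiv[where f = f and g = g])
    show "constant_on_arcs (\<psi> \<circ> f) ?E"
      if "constant_on_arcs \<psi> ?F"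
      for \<psi> :: "hitch_point \<Rightarrow> hitch_point set"
      using that by (simp add: f_row, simp add: f_def right_ends_def vertical_def knot_arcs_def ringbolt_arcs_def)
    show "constant_on_arcs (\<phi> \<circ> g) ?F"
      if "constant_on_arcs \<phi> ?E"
      for \<phi> :: "hitch_point \<Rightarrow> hitch_point set"
      using that by (simp add: g_row, simp add: g_def right_ends_def vertical_def knot_arcs_def ringbolt_arcs_def)
    show "\<phi> (g (f x)) = \<phi> x"
      if "constant_on_arcs \<phi> ?E"
      for \<phi> :: "hitch_point \<Rightarrow> hitch_point set" and x
      using that
      by (simp add: f_def g_def right_ends_def vertical_def knot_arcs_def ringbolt_arcs_def) argo
    show "\<psi> (f (g y)) = \<psi> y"
      if "constant_on_arcs \<psi> ?F" "y \<in> row_points n"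
      for \<psi> :: "hitch_point \<Rightarrow> hitch_point set" and y
      using that by (auto simp: f_def g_def right_ends_def vertical_def knot_arcs_def ringbolt_arcs_def
          row_points_def)
  qed (auto simp: f_def g_def row_points_def)
qed

text \<open>
  Here the right part of the vertical tangle and the right arc of the knot closure form a circle of
  their own, which \<open>f\<close> contracts to the single point \<open>?z\<close>; the left part of the tangle again takes
  over the role of the right closing arc.
\<close>

lemma tangle_circles_vertical_knot:
  "tangle_circles n knot_arcs S (vertical n) = Suc (card (circles (hitch_knot n) S))"
proof -
  let ?E = "row_state n S \<union> right_ends (Suc n) \<union> knot_arcs \<union> vertical n"
    and ?F = "row_state n S \<union> right_ends n \<union> knot_arcs"
  let ?z = "Mark (Seam (Suc n) Upper) :: hitch_point"
  define f where "f = (\<lambda>x :: hitch_point.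
    if x \<in> {?z, Mark (Seam (Suc n) Lower), Mark (Boundary NE), Mark (Boundary SE)} then ?z else x)"
  define g where "g = (\<lambda>x :: hitch_point. if x = Mark (Boundary NE) then Mark (Seam n Upper)
    else if x = Mark (Boundary SE) then Mark (Seam n Lower) else x)"
  have f_row: "constant_on_arcs (\<psi> \<circ> f) (row_state n S) \<longleftrightarrow> constant_on_arcs \<psi> (row_state n S)"
    for \<psi> :: "hitch_point \<Rightarrow> hitch_point set"
    by (rule constant_on_row_state_cong) (simp add: f_def)
  have g_row: "constant_on_arcs (\<psi> \<circ> g) (row_state n S) \<longleftrightarrow> constant_on_arcs \<psi> (row_state n S)"
    for \<psi> :: "hitch_point \<Rightarrow> hitch_point set"
    by (rule constant_on_row_state_cong) (simp add: g_def)
  have "tangle_circles n knot_arcs S (vertical n) =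
      num_components (insert ?z (row_points n)) (row_state n S \<union> right_ends n \<union> knot_arcs)"
    unfolding tangle_circles_def
  proof (rule num_components_equiv[where f = f and g = g])
    show "constant_on_arcs (\<psi> \<circ> f) ?E"
      if "constant_on_arcs \<psi> ?F"
      for \<psi> :: "hitch_point \<Rightarrow> hitch_point set"
      using that by (simp add: f_row, simp add: f_def right_ends_def vertical_def knot_arcs_def)
    show "constant_on_arcs (\<phi> \<circ> g) ?F"
      if "constant_on_arcs \<phi> ?E"
      for \<phi> :: "hitch_point \<Rightarrow> hitch_point set"
      using that by (simp add: g_row, simp add: g_def right_ends_def vertical_def knot_arcs_def)
    show "\<phi> (g (f x)) = \<phi> x"
      if "constant_on_arcs \<phi> ?E"
      for \<phi> :: "hitch_point \<Rightarrow> hitch_point set" and x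
      using that by (simp add: f_def g_def right_ends_def vertical_def knot_arcs_def)
    show "\<psi> (f (g y)) = \<psi> y"
      if "constant_on_arcs \<psi> ?F" "y \<in> insert ?z (row_points n)"
      for \<psi> :: "hitch_point \<Rightarrow> hitch_point set" and y
      using that by (auto simp: f_def g_def right_ends_def vertical_def knot_arcs_def row_points_def)
  qed (auto simp: f_def g_def row_points_def)
  also have "\<dots> = Suc (num_components (row_points n) (row_state n S \<union> right_ends n \<union> knot_arcs))"
  proof (rule num_components_insert_isolated[OF finite_row_points])
    show "?z \<notin> row_points n"
      by (simp add: row_points_def)
    show "?z \<notin> \<Union>(row_state n S \<union> right_ends n \<union> knot_arcs)"
      using row_state_avoids(1)[of ?z n S Upper] by (auto simp: right_ends_def knot_arcs_def)
  qed
  finally show ?thesis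
    by (simp add: card_circles hitch_knot_def knot_arcs_def points_hitch_diagram state_arcs_hitch_diagram)
qed

section \<open>Recurrences for the generating polynomials\<close>

lemma states_hitch_diagram: "states (hitch_diagram n outer) = {..<n} \<times> UNIV \<rightarrow>\<^sub>E UNIV"
  by (simp add: states_def hitch_diagram_def)

lemma UNIV_split: "(UNIV :: split set) = {Split0, Split1}"
  using split.exhaust by auto

lemma sum_states_Suc:
  fixes F :: "(hitch_crossing \<Rightarrow> split) \<Rightarrow> 'x :: comm_monoid_add"
  shows "(\<Sum>S \<in> states (hitch_diagram (Suc n) outer). F S) =
    (\<Sum>S \<in> states (hitch_diagram n outer). \<Sum>a \<in> UNIV. \<Sum>b \<in> UNIV. \<Sum>c \<in> UNIV. F (extend_state n S a b c))"
proof -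
  have "(\<Sum>S \<in> states (hitch_diagram (Suc n) outer). F S) =
    (\<Sum>(S, a, b, c) \<in> states (hitch_diagram n outer) \<times> UNIV \<times> UNIV \<times> UNIV. F (extend_state n S a b c))"
  proof (rule sum.reindex_bij_witness[where
        j = "\<lambda>S. (restrict S ({..<n} \<times> UNIV), S (n, Cross_a), S (n, Cross_b), S (n, Cross_c))" and
        i = "\<lambda>(S, a, b, c). extend_state n S a b c"])
    fix S :: "hitch_crossing \<Rightarrow> split"
    assume S: "S \<in> states (hitch_diagram (Suc n) outer)"
    have "extend_state n (restrict S ({..<n} \<times> UNIV)) (S (n, Cross_a)) (S (n, Cross_b)) (S (n, Cross_c)) = S"
    proof
      fix x :: hitch_crossing
      obtain i b where x: "x = (i, b)" by (cases x)
      have "S (i, b) = undefined" if "n < i"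
        using that by (intro PiE_arb[OF S[unfolded states_hitch_diagram]]) simp
      then show "extend_state n (restrict S ({..<n} \<times> UNIV)) (S (n, Cross_a)) (S (n, Cross_b)) (S (n, Cross_c)) x = S x"
        by (cases b; cases i n rule: linorder_cases) (simp_all add: extend_state_def x)
    qed
    then show "(case (restrict S ({..<n} \<times> UNIV), S (n, Cross_a), S (n, Cross_b), S (n, Cross_c)) of
        (S, a, b, c) \<Rightarrow> extend_state n S a b c) = S"
      and "(case (restrict S ({..<n} \<times> UNIV), S (n, Cross_a), S (n, Cross_b), S (n, Cross_c)) of
        (S, a, b, c) \<Rightarrow> F (extend_state n S a b c)) = F S"
      by simp_all
    show "(restrict S ({..<n} \<times> UNIV), S (n, Cross_a), S (n, Cross_b), S (n, Cross_c))
        \<in> states (hitch_diagram n outer) \<times> UNIV \<times> UNIV \<times> UNIV"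
      by (simp add: states_hitch_diagram)
  next
    fix y assume y: "y \<in> states (hitch_diagram n outer) \<times> (UNIV :: split set) \<times> (UNIV :: split set) \<times> (UNIV :: split set)"
    then obtain S a b c where y_eq: "y = (S, a, b, c)" and S: "S \<in> states (hitch_diagram n outer)"
      by auto
    have "restrict (extend_state n S a b c) ({..<n} \<times> UNIV) = S"
    proof
      fix x :: hitch_crossing
      show "restrict (extend_state n S a b c) ({..<n} \<times> UNIV) x = S x"
        using PiE_arb[OF S[unfolded states_hitch_diagram], of x]
        by (cases x) (auto simp: extend_state_def)
    qed
    then show "(\<lambda>S. (restrict S ({..<n} \<times> UNIV), S (n, Cross_a), S (n, Cross_b), S (n, Cross_c)))
        (case y of (S, a, b, c) \<Rightarrow> extend_state n S a b c) = y"
      by (simp add: y_eq extend_state_def)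
    show "(case y of (S, a, b, c) \<Rightarrow> extend_state n S a b c) \<in> states (hitch_diagram (Suc n) outer)"
      using S by (auto simp: y_eq states_hitch_diagram extend_state_def PiE_iff extensional_def)
  qed
  then show ?thesis
    by (simp only: sum.cartesian_product)
qed

text \<open>
  Summing over the eight states of the last block, the horizontal tangle occurs with weights
  \<open>1, 1, 1, x, x\<close> and the vertical one with weights \<open>1, 1, x\<close>.
\<close>

lemma gen_poly_hitch_diagram_Suc:
  assumes outer: "\<Union>outer \<subseteq> range (Mark \<circ> Boundary)"
  shows "gen_poly (hitch_diagram (Suc n) outer) =
    [:3, 2:] * gen_poly (hitch_diagram n outer) +
    [:2, 1:] * (\<Sum>S \<in> states (hitch_diagram n outer). monom 1 (tangle_circles n outer S (vertical n)))"
proof -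
  define x :: "int poly" where "x = [:0, 1:]"
  have coeffs: "[:3, 2:] = 2 * x + 3" "[:2, 1:] = x + 2"
    by (simp_all add: x_def numeral_poly)
  have monom_x: "monom 1 (Suc m) = x * monom 1 m" for m
    by (simp add: x_def monom_Suc)
  have block: "(\<Sum>a \<in> UNIV. \<Sum>b \<in> UNIV. \<Sum>c \<in> UNIV.
        monom 1 (card (circles (hitch_diagram (Suc n) outer) (extend_state n S a b c)))) =
      [:3, 2:] * monom 1 (card (circles (hitch_diagram n outer) S)) +
      [:2, 1:] * (monom 1 (tangle_circles n outer S (vertical n)) :: int poly)" for S
    unfolding card_circles_extend_state[OF outer] UNIV_split coeffs
    by (simp add: tangle_circles_horizontal[OF outer] monom_x algebra_simps)
  show ?thesis
    unfolding gen_poly_def sum_states_Suc block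
    by (simp add: sum.distrib sum_distrib_left)
qed

lemma gen_poly_ringbolt_Suc:
  "gen_poly (ringbolt_hitching (Suc n)) =
    [:3, 2:] * gen_poly (ringbolt_hitching n) + [:2, 1:] * gen_poly (hitch_knot n)"
proof -
  have "states (hitch_diagram n ringbolt_arcs) = states (hitch_knot n)"
    by (simp add: hitch_knot_def states_hitch_diagram)
  moreover have "\<Union>ringbolt_arcs \<subseteq> range (Mark \<circ> Boundary)"
    by (auto simp: ringbolt_arcs_def)
  ultimately show ?thesis
    using gen_poly_hitch_diagram_Suc[of ringbolt_arcs n]
    by (simp add: tangle_circles_vertical_ringbolt ringbolt_hitching_def
      ringbolt_arcs_def[symmetric] gen_poly_def[of "hitch_knot n"])
qed

lemma gen_poly_knot_Suc:
  "gen_poly (hitch_knot (Suc n)) = [:3, 4, 1:] * gen_poly (hitch_knot n)"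
proof -
  have knot: "hitch_diagram m knot_arcs = hitch_knot m" for m
    by (simp add: hitch_knot_def knot_arcs_def)
  have "\<Union>knot_arcs \<subseteq> range (Mark \<circ> Boundary)"
    by (auto simp: knot_arcs_def)
  from gen_poly_hitch_diagram_Suc[OF this, of n]
  have "gen_poly (hitch_knot (Suc n)) =
      [:3, 2:] * gen_poly (hitch_knot n) + [:2, 1:] * ([:0, 1:] * gen_poly (hitch_knot n))"
    by (simp add: knot tangle_circles_vertical_knot monom_Suc gen_poly_def sum_distrib_left)
  also have "\<dots> = ([:3, 2:] + [:2, 1:] * [:0, 1:]) * gen_poly (hitch_knot n)"
    by (simp only: distrib_right mult.assoc)
  finally show ?thesis
    by simp
qed

section \<open>Rows without blocks\<close>

lemma row_points_0:
  "row_points 0 = {Mark (Seam 0 Upper), Mark (Seam 0 Lower), Mark (Boundary NW), Mark (Boundary NE),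
     Mark (Boundary SW), Mark (Boundary SE)}"
  using level_Upper_or_Lower by (force simp: row_points_def)

text \<open>
  Without crossings there is a single state, and \<open>row_state\<close> does not consult it; so \<open>S\<close> is arbitrary.
\<close>

lemma gen_poly_no_blocks:
  "gen_poly (hitch_diagram 0 outer) = monom 1 (num_components (row_points 0) (row_state 0 S \<union> right_ends 0 \<union> outer))"
  by (simp add: gen_poly_def states_hitch_diagram card_circles points_hitch_diagram
    state_arcs_hitch_diagram row_state_def)

lemma gen_poly_knot_0: "gen_poly (hitch_knot 0) = [:0, 1:]"
proof -
  let ?u = "Mark (Seam 0 Upper) :: hitch_point"
  have "num_components (row_points 0) (row_state 0 S \<union> right_ends 0 \<union> knot_arcs) =
      num_components {?u} {}" for S
    by (rule num_components_retract[where r = "\<lambda>_. ?u"])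
      (auto simp: row_points_0 row_state_def right_ends_def knot_arcs_def)
  then show ?thesis
    by (simp add: hitch_knot_def knot_arcs_def[symmetric] gen_poly_no_blocks[of _ undefined]
      num_components_insert_isolated num_components_def[of "{}"] monom_Suc)
qed

lemma gen_poly_ringbolt_0: "gen_poly (ringbolt_hitching 0) = [:0, 0, 1:]"
proof -
  let ?u = "Mark (Seam 0 Upper) :: hitch_point" and ?l = "Mark (Seam 0 Lower) :: hitch_point"
  let ?r = "\<lambda>x. if x \<in> {?u, Mark (Boundary NW), Mark (Boundary NE)} then ?u else ?l"
  have "num_components (row_points 0) (row_state 0 S \<union> right_ends 0 \<union> ringbolt_arcs) =
      num_components {?u, ?l} {}" for S
    by (rule num_components_retract[where r = ?r])
      (auto simp: row_points_0 row_state_def right_ends_def ringbolt_arcs_def)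
  then show ?thesis
    by (simp add: ringbolt_hitching_def ringbolt_arcs_def[symmetric] gen_poly_no_blocks[of _ undefined]
      num_components_insert_isolated num_components_def[of "{}"] monom_Suc)
qed

theorem theorem49:
  fixes n :: nat
  shows "(1 \<le> n \<longrightarrow>
            gen_poly (ringbolt_hitching n) =
              [:3, 2:] * gen_poly (ringbolt_hitching (n - 1)) + [:2, 1:] * gen_poly (hitch_knot (n - 1))) \<and>
         gen_poly (ringbolt_hitching n) = [:3, 4, 1:] ^ n + [:-1, 0, 1:] * [:3, 2:] ^ n"
proof
  show "1 \<le> n \<longrightarrow> gen_poly (ringbolt_hitching n) =
      [:3, 2:] * gen_poly (ringbolt_hitching (n - 1)) + [:2, 1:] * gen_poly (hitch_knot (n - 1))"
    by (cases n) (simp_all add: gen_poly_ringbolt_Suc)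
  have knot: "gen_poly (hitch_knot m) = [:0, 1:] * [:3, 4, 1:] ^ m" for m
    by (induction m) (simp_all add: gen_poly_knot_0 gen_poly_knot_Suc mult.left_commute)
  show "gen_poly (ringbolt_hitching n) = [:3, 4, 1:] ^ n + [:-1, 0, 1:] * [:3, 2:] ^ n"
  proof (induction n)
    case 0
    then show ?case by (simp add: gen_poly_ringbolt_0 one_pCons)
  next
    case (Suc n)
    have "[:3, 4, 1:] = [:3, 2:] + [:2, 1:] * [:0, 1 :: int:]"
      by simp
    then have "[:3, 4, 1:] ^ Suc n = ([:3, 2:] + [:2, 1:] * [:0, 1 :: int:]) * [:3, 4, 1:] ^ n"
      by (simp only: power_Suc)
    then show ?case
      unfolding gen_poly_ringbolt_Suc Suc knot by (simp only: power_Suc ring_distribs ac_simps)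
  qed
qed

end
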